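(* Let $n \ge 2$ and let $f \colon \mathbb{R}^n \to \mathbb{R}$ be a nonconstant polynomial. Suppose that $\mathcal{Z}(f)$ is compact. Then: (i) $f|_{\mathbb{R}^J} \not\equiv 0$ for all nonempty $J \subseteq \{1,\ldots,n\}$; (ii) one of the following statements holds: (ii1) $f$ is bounded from below and $f_{\Delta} \ge 0$ on $\mathbb{R}^n$ for all $\Delta \in \Gamma_{\infty}(f)$; (ii2) $f$ is bounded from above and $f_{\Delta} \le 0$ on $\mathbb{R}^n$ for all $\Delta \in \Gamma_{\infty}(f)$.
   Context: $\mathcal{Z}(f) := \{x \in \mathbb{R}^n \mid f(x) = 0\}$ is the zero set of $f$. For $J \subseteq \{1,\ldots,n\}$, $\mathbb{R}^J := \{x \in \mathbb{R}^n \mid x_j = 0 \text{ for all } j \notin J\}$. Write $f = \sum_{\alpha} a_\alpha x^\alpha$ with $\alpha \in \mathbb{Z}_+^n$ (tuples of non-negative integers) and $x^\alpha = x_1^{\alpha_1}\cdots x_n^{\alpha_n}$. The Newton polyhedron $\Gamma(f)$ is the convex hull in $\mathbb{R}^n$ of $\{\alpha \mid a_\alpha \neq 0\}$ (the origin is not added). For nonzero $q \in \mathbb{R}^n$ let $d(q,\Gamma(f)) := \min\{\langle q,\alpha\rangle \mid \alpha \in \Gamma(f)\}$ and $\Delta(q,\Gamma(f)) := \{\alpha \in \Gamma(f) \mid \langle q,\alpha\rangle = d(q,\Gamma(f))\}$, which is a face of $\Gamma(f)$. The Newton boundary at infinity $\Gamma_\infty(f)$ consists of all faces $\Delta(q,\Gamma(f))$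 with $q \in \mathbb{R}^n$ and $\min_{j=1,\ldots,n} q_j < 0$; "$\Delta \in \Gamma_\infty(f)$" means that $\Delta$ is one of these faces. For a face $\Delta$ of $\Gamma(f)$, $f_\Delta := \sum_{\alpha \in \Delta} a_\alpha x^\alpha$. *)

theory Defs
  imports "HOL-Analysis.Analysis" "HOL-Library.Poly_Mapping"
begin

text \<open>
  A real polynomial in the variables indexed by a finite type \<open>'n\<close> is a finitely supported
  map from exponents (themselves finitely supported maps \<open>'n \<Rightarrow>\<^sub>0 nat\<close>) to coefficients.
\<close>

type_synonym 'n mpoly = "('n \<Rightarrow>\<^sub>0 nat) \<Rightarrow>\<^sub>0 real"

definition monom_eval :: "('n::finite \<Rightarrow>\<^sub>0 nat) \<Rightarrow> real ^ 'n \<Rightarrow> real" where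
  "monom_eval \<alpha> x = (\<Prod>j\<in>UNIV. (x $ j) ^ Poly_Mapping.lookup \<alpha> j)"

definition mpoly_eval :: "'n::finite mpoly \<Rightarrow> real ^ 'n \<Rightarrow> real" where
  "mpoly_eval f x =
    (\<Sum>\<alpha>\<in>Poly_Mapping.keys f. Poly_Mapping.lookup f \<alpha> * monom_eval \<alpha> x)"

definition zero_set :: "'n::finite mpoly \<Rightarrow> (real ^ 'n) set" where
  "zero_set f = {x. mpoly_eval f x = 0}"

definition coord_subspace :: "'n::finite set \<Rightarrow> (real ^ 'n) set" where
  "coord_subspace J = {x. \<forall>j. j \<notin> J \<longrightarrow> x $ j = 0}"

definition exp_vec :: "('n::finite \<Rightarrow>\<^sub>0 nat) \<Rightarrow> real ^ 'n" where
  "exp_vec \<alpha> = (\<chi> j. real (Poly_Mapping.lookup \<alpha> j))"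

definition newton_polyhedron :: "'n::finite mpoly \<Rightarrow> (real ^ 'n) set" where
  "newton_polyhedron f = convex hull (exp_vec ` Poly_Mapping.keys f)"

text \<open>
  The infimum below is a minimum whenever \<open>P\<close> is compact and nonempty; see
  \<open>min_value_attained\<close> for the Newton polyhedron of a nonzero polynomial.
\<close>

definition min_value :: "real ^ 'n::finite \<Rightarrow> (real ^ 'n) set \<Rightarrow> real" where
  "min_value q P = (INF \<alpha>\<in>P. q \<bullet> \<alpha>)"

definition min_face :: "real ^ 'n::finite \<Rightarrow> (real ^ 'n) set \<Rightarrow> (real ^ 'n) set" where
  "min_face q P = {\<alpha> \<in> P. q \<bullet> \<alpha> = min_value q P}"

definition newton_boundary_infinity :: "'n::finite mpoly \<Rightarrow> (real ^ 'n) set set" where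
  "newton_boundary_infinity f =
    {min_face q (newton_polyhedron f) | q. (MIN j. q $ j) < 0}"

definition face_part :: "'n::finite mpoly \<Rightarrow> (real ^ 'n) set \<Rightarrow> 'n mpoly" where
  "face_part f \<Delta> =
    (\<Sum>\<alpha> | \<alpha> \<in> Poly_Mapping.keys f \<and> exp_vec \<alpha> \<in> \<Delta>.
      Poly_Mapping.single \<alpha> (Poly_Mapping.lookup f \<alpha>))"

lemma min_value_attained:
  fixes f :: "'n::finite mpoly"
  assumes "f \<noteq> 0"
  shows "\<exists>\<alpha>\<in>newton_polyhedron f. q \<bullet> \<alpha> = min_value q (newton_polyhedron f)
           \<and> (\<forall>\<beta>\<in>newton_polyhedron f. q \<bullet> \<alpha> \<le> q \<bullet> \<beta>)"
proof -
  let ?P = "newton_polyhedron f"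
  have "compact ?P"
    by (simp add: newton_polyhedron_def finite_imp_compact_convex_hull)
  moreover have "?P \<noteq> {}"
    using assms by (simp add: newton_polyhedron_def)
  moreover have "continuous_on ?P (\<lambda>\<alpha>. q \<bullet> \<alpha>)"
    by (intro continuous_intros)
  ultimately obtain \<alpha> where \<alpha>: "\<alpha> \<in> ?P" "\<forall>\<beta>\<in>?P. q \<bullet> \<alpha> \<le> q \<bullet> \<beta>"
    using continuous_attains_inf by blast
  have "min_value q ?P = q \<bullet> \<alpha>"
    unfolding min_value_def using \<alpha> by (intro cInf_eq_minimum) auto
  with \<alpha> show ?thesis by auto
qed

end

theory Submission
  imports Defs
begin

text \<open>
  The complement of a ball is connected in dimension at least two, so \<open>f\<close> has a constant
  sign \<open>c\<close> outside a large ball. For a face \<open>\<Delta>(q)\<close> with some \<open>q\<^sub>j < 0\<close> and a point \<open>x\<close> with no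
  zero coordinate, follow the curve \<open>x(s)\<^sub>j = exp (- s q\<^sub>j) x\<^sub>j\<close>: it tends to infinity, and
  \<open>exp (s d(q)) f(x(s))\<close> tends to \<open>f\<^sub>\<Delta>(x)\<close>, which thus inherits the sign \<open>c\<close>.
  The points with no zero coordinate are dense.
\<close>

lemma continuous_on_mpoly_eval: "continuous_on S (mpoly_eval f)"
  unfolding mpoly_eval_def monom_eval_def by (intro continuous_intros)

lemma lookup_face_part:
  "Poly_Mapping.lookup (face_part f \<Delta>) \<alpha> =
    (if exp_vec \<alpha> \<in> \<Delta> then Poly_Mapping.lookup f \<alpha> else 0)"
  by (auto simp: face_part_def lookup_sum lookup_single when_def in_keys_iff)

text \<open>Indexing by the keys of \<open>f\<close>, with zeros off the face, lets the limit along
  the curve be taken term by term.\<close>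

lemma mpoly_eval_face_part:
  "mpoly_eval (face_part f \<Delta>) x =
    (\<Sum>\<alpha>\<in>Poly_Mapping.keys f.
      if exp_vec \<alpha> \<in> \<Delta> then Poly_Mapping.lookup f \<alpha> * monom_eval \<alpha> x else 0)"
proof -
  have "Poly_Mapping.keys (face_part f \<Delta>) \<subseteq> Poly_Mapping.keys f"
    by (auto simp: in_keys_iff lookup_face_part split: if_splits)
  then show ?thesis
    unfolding mpoly_eval_def
    by (intro sum.mono_neutral_cong_left) (auto simp: in_keys_iff lookup_face_part split: if_splits)
qed

text \<open>With t = exp(-s) this is the weighted scaling by t^(q_j), whose real exponents q_j may
  be negative. Each monomial picks up the single factor t^(q \<bullet> \<alpha>), so the weight q
  alone decides which terms dominate as s grows.\<close>

lemma monom_eval_weighted_scaling: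
  "monom_eval \<alpha> (\<chi> j. exp (- (s * q $ j)) * x $ j) =
    exp (- (s * (q \<bullet> exp_vec \<alpha>))) * monom_eval \<alpha> x"
  by (simp add: monom_eval_def power_mult_distrib prod.distrib exp_vec_def inner_vec_def
      exp_of_nat_mult[symmetric] exp_sum[symmetric] sum_distrib_left sum_negf[symmetric] ac_simps)

lemma min_value_le:
  assumes "\<alpha> \<in> Poly_Mapping.keys f"
  shows "min_value q (newton_polyhedron f) \<le> q \<bullet> exp_vec \<alpha>"
proof -
  have "exp_vec \<alpha> \<in> newton_polyhedron f"
    using assms by (simp add: newton_polyhedron_def hull_inc)
  moreover have "f \<noteq> 0"
    using assms by auto
  ultimately show ?thesis
    by (metis min_value_attained)
qed

text \<open>After multiplication by exp(s d) the term of \<alpha> carries the factor exp(-s (q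
  \<bullet> \<alpha> - d)). It is constantly 1 on the face; off the face minimality of d makes the
  gap positive, so it decays to 0.\<close>

lemma tendsto_face_part:
  defines "d \<equiv> \<lambda>q f. min_value q (newton_polyhedron f)"
  shows "((\<lambda>s. exp (s * d q f) * mpoly_eval f (\<chi> j. exp (- (s * q $ j)) * x $ j)) \<longlongrightarrow>
    mpoly_eval (face_part f (min_face q (newton_polyhedron f))) x) at_top"
proof -
  have "((\<lambda>s. Poly_Mapping.lookup f \<alpha> * monom_eval \<alpha> x * exp (- (s * (q \<bullet> exp_vec \<alpha> - d q f))))
      \<longlongrightarrow> (if exp_vec \<alpha> \<in> min_face q (newton_polyhedron f)
           then Poly_Mapping.lookup f \<alpha> * monom_eval \<alpha> x else 0)) at_top"
    if \<alpha>: "\<alpha> \<in> Poly_Mapping.keys f" for \<alpha>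
  proof (cases "q \<bullet> exp_vec \<alpha> = d q f")
    case True
    moreover have "exp_vec \<alpha> \<in> newton_polyhedron f"
      using \<alpha> by (simp add: newton_polyhedron_def hull_inc)
    ultimately show ?thesis
      by (simp add: min_face_def d_def)
  next
    case False
    then have "q \<bullet> exp_vec \<alpha> - d q f > 0"
      using min_value_le[OF \<alpha>, of q] by (simp add: d_def)
    then have "filterlim (\<lambda>s. s * (q \<bullet> exp_vec \<alpha> - d q f)) at_top at_top"
      by (intro filterlim_at_top_mult_tendsto_pos[OF tendsto_const] filterlim_ident)
    then have "((\<lambda>s. exp (- (s * (q \<bullet> exp_vec \<alpha> - d q f)))) \<longlongrightarrow> 0) at_top"
      by (intro filterlim_compose[OF exp_at_bot])
        (simp add: filterlim_uminus_at_bot del: minus_diff_eq)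
    then have "((\<lambda>s. Poly_Mapping.lookup f \<alpha> * monom_eval \<alpha> x
        * exp (- (s * (q \<bullet> exp_vec \<alpha> - d q f)))) \<longlongrightarrow> 0) at_top"
      by (rule tendsto_mult_right_zero)
    then show ?thesis
      using False by (simp add: min_face_def d_def)
  qed
  then have "((\<lambda>s. \<Sum>\<alpha>\<in>Poly_Mapping.keys f. Poly_Mapping.lookup f \<alpha> * monom_eval \<alpha> x
      * exp (- (s * (q \<bullet> exp_vec \<alpha> - d q f)))) \<longlongrightarrow>
      mpoly_eval (face_part f (min_face q (newton_polyhedron f))) x) at_top"
    unfolding mpoly_eval_face_part by (rule tendsto_sum)
  moreover have "exp (s * d q f) * mpoly_eval f (\<chi> j. exp (- (s * q $ j)) * x $ j) =
      (\<Sum>\<alpha>\<in>Poly_Mapping.keys f. Poly_Mapping.lookup f \<alpha> * monom_eval \<alpha> x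
        * exp (- (s * (q \<bullet> exp_vec \<alpha> - d q f))))" for s
    unfolding mpoly_eval_def monom_eval_weighted_scaling
    by (simp add: sum_distrib_left right_diff_distrib exp_diff exp_minus field_simps)
  ultimately show ?thesis
    by simp
qed

text \<open>The scalar \<open>c\<close> stands for the sign, 1 or -1, so that both alternatives of
  the theorem share one argument.\<close>

lemma face_part_sign_nonzero_coords:
  fixes f :: "'n::finite mpoly"
  assumes sign: "\<And>y. norm y > R \<Longrightarrow> 0 \<le> c * mpoly_eval f y"
    and \<Delta>: "\<Delta> \<in> newton_boundary_infinity f"
    and x: "\<And>j. x $ j \<noteq> 0"
  shows "0 \<le> c * mpoly_eval (face_part f \<Delta>) x"
proof -
  obtain q where q: "\<Delta> = min_face q (newton_polyhedron f)" "(MIN j. q $ j) < 0"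
    using \<Delta> by (auto simp: newton_boundary_infinity_def)
  then obtain j where j: "q $ j < 0"
    by (auto simp: Min_less_iff)
  let ?y = "\<lambda>s. \<chi> j. exp (- (s * q $ j)) * x $ j"
  \<comment> \<open>The curve leaves every ball because its j-th coordinate alone diverges: q_j is
    negative and x_j is nonzero.\<close>
  have "filterlim (\<lambda>s. s * - (q $ j)) at_top at_top"
    using j by (intro filterlim_at_top_mult_tendsto_pos[OF tendsto_const] filterlim_ident) simp
  then have "filterlim (\<lambda>s. exp (- (s * q $ j))) at_top at_top"
    by (intro filterlim_compose[OF exp_at_top]) simp
  then have "filterlim (\<lambda>s. exp (- (s * q $ j)) * \<bar>x $ j\<bar>) at_top at_top"
    using x by (intro filterlim_at_top_mult_tendsto_pos[OF tendsto_const]) simp_all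
  then have "\<forall>\<^sub>F s in at_top. R < exp (- (s * q $ j)) * \<bar>x $ j\<bar>"
    by (simp add: filterlim_at_top_dense)
  then have "\<forall>\<^sub>F s in at_top. 0 \<le>
      c * (exp (s * min_value q (newton_polyhedron f)) * mpoly_eval f (?y s))"
  proof eventually_elim
    case (elim s)
    have "exp (- (s * q $ j)) * \<bar>x $ j\<bar> \<le> norm (?y s)"
      using component_le_norm_cart[of "?y s" j] by (simp add: abs_mult)
    with elim have "0 \<le> c * mpoly_eval f (?y s)"
      by (intro sign) simp
    then show ?case
      by (metis exp_ge_zero mult.left_commute mult_nonneg_nonneg)
  qed
  then show ?thesis
    unfolding q
    by (rule tendsto_lowerbound[OF tendsto_mult_left[OF tendsto_face_part]]) simp
qed

lemma face_part_sign:
  fixes f :: "'n::finite mpoly"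
  assumes sign: "\<And>y. norm y > R \<Longrightarrow> 0 \<le> c * mpoly_eval f y"
    and \<Delta>: "\<Delta> \<in> newton_boundary_infinity f"
  shows "0 \<le> c * mpoly_eval (face_part f \<Delta>) x"
proof -
  \<comment> \<open>Shifting along the all-ones vector kills the j-th coordinate only at e = -x_j,
    so for all small nonzero e no coordinate vanishes.\<close>
  let ?y = "\<lambda>e::real. x + (\<chi> j. e)"
  have "\<forall>\<^sub>F e in at 0. \<forall>j\<in>UNIV. ?y e $ j \<noteq> 0"
  proof (intro eventually_ball_finite ballI)
    fix j
    show "\<forall>\<^sub>F e in at 0. ?y e $ j \<noteq> 0"
    proof (cases "x $ j = 0")
      case True
      \<comment> \<open>The one bad value here is e = 0, which the punctured filter
        \<open>at 0\<close> excludes.\<close>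
      then show ?thesis
        by (simp add: eventually_at_filter)
    next
      case False
      have "((\<lambda>e. x $ j + e) \<longlongrightarrow> x $ j + 0) (at 0)"
        by (intro tendsto_intros)
      then show ?thesis
        using tendsto_imp_eventually_ne False by fastforce
    qed
  qed simp
  then have "\<forall>\<^sub>F e in at 0. 0 \<le> c * mpoly_eval (face_part f \<Delta>) (?y e)"
    by eventually_elim (intro face_part_sign_nonzero_coords[OF sign \<Delta>], auto)
  moreover have "((\<lambda>e. c * mpoly_eval (face_part f \<Delta>) (?y e)) \<longlongrightarrow>
      c * mpoly_eval (face_part f \<Delta>) (?y 0)) (at 0)"
    unfolding mpoly_eval_def monom_eval_def by (auto intro!: tendsto_eq_intros)
  ultimately have "0 \<le> c * mpoly_eval (face_part f \<Delta>) (?y 0)"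
    by (intro tendsto_lowerbound[of _ _ "at (0::real)"]) auto
  moreover have "?y 0 = x"
    by (simp add: vec_eq_iff)
  ultimately show ?thesis
    by simp
qed

lemma bdd_below_range_if_nonneg_outside_ball:
  fixes g :: "real ^ 'n::finite \<Rightarrow> real"
  assumes "continuous_on (cball 0 R) g" and "\<And>y. norm y > R \<Longrightarrow> 0 \<le> g y"
  shows "bdd_below (range g)"
proof -
  have "bdd_below (g ` cball 0 R)"
    using assms(1) by (intro bounded_imp_bdd_below compact_imp_bounded compact_continuous_image) auto
  moreover have "bdd_below (g ` (- cball 0 R))"
    using assms(2) by (intro bdd_belowI[of _ 0]) (auto simp: not_le)
  ultimately have "bdd_below (g ` (cball 0 R \<union> - cball 0 R))"
    unfolding image_Un by simp
  then show ?thesis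
    unfolding Compl_partition .
qed

lemma coord_subspace_not_bounded:
  fixes J :: "'n::finite set"
  assumes "J \<noteq> {}"
  shows "\<not> bounded (coord_subspace J)"
proof
  assume "bounded (coord_subspace J)"
  then obtain B where B: "\<And>x. x \<in> coord_subspace J \<Longrightarrow> norm x \<le> B"
    by (auto simp: bounded_iff)
  obtain j where "j \<in> J"
    using assms by auto
  \<comment> \<open>The j-th coordinate of this point already exceeds the supposed bound B.\<close>
  then have "axis j (\<bar>B\<bar> + 1) \<in> coord_subspace J"
    by (auto simp: coord_subspace_def axis_def)
  from B[OF this] have "norm (axis j (\<bar>B\<bar> + 1) :: real ^ 'n) \<le> B" .
  with component_le_norm_cart[of "axis j (\<bar>B\<bar> + 1) :: real ^ 'n" j] show False
    by simp
qed

theorem theorem3p1: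
  fixes f :: "'n::finite mpoly"
  assumes "CARD('n) \<ge> 2"
    and "\<not> mpoly_eval f constant_on UNIV"
    and "compact (zero_set f)"
  shows "(\<forall>J. J \<noteq> {} \<longrightarrow> (\<exists>x\<in>coord_subspace J. mpoly_eval f x \<noteq> 0)) \<and>
    ((bdd_below (range (mpoly_eval f)) \<and>
        (\<forall>\<Delta>\<in>newton_boundary_infinity f. \<forall>x. mpoly_eval (face_part f \<Delta>) x \<ge> 0)) \<or>
     (bdd_above (range (mpoly_eval f)) \<and>
        (\<forall>\<Delta>\<in>newton_boundary_infinity f. \<forall>x. mpoly_eval (face_part f \<Delta>) x \<le> 0)))"
proof (intro conjI)
  have "bounded (zero_set f)"
    using assms(3) by (rule compact_imp_bounded)
  \<comment> \<open>If \<open>f\<close> vanished on a coordinate subspace, that unbounded set would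
    lie in the bounded zero set.\<close>
  then show "\<forall>J. J \<noteq> {} \<longrightarrow> (\<exists>x\<in>coord_subspace J. mpoly_eval f x \<noteq> 0)"
    using coord_subspace_not_bounded bounded_subset[of "zero_set f"]
    unfolding zero_set_def subset_iff mem_Collect_eq by blast
  obtain R where R: "\<And>x. mpoly_eval f x = 0 \<Longrightarrow> norm x \<le> R"
    using \<open>bounded (zero_set f)\<close> by (auto simp: bounded_iff zero_set_def)
  let ?U = "- cball 0 R :: (real ^ 'n) set"
  have "connected ?U"
    using assms(1) by (intro connected_complement_bounded_convex) auto
  then have conn: "connected (mpoly_eval f ` ?U)"
    by (intro connected_continuous_image continuous_on_mpoly_eval)
  have sign: "(\<forall>y. norm y > R \<longrightarrow> 0 \<le> 1 * mpoly_eval f y) \<or>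
      (\<forall>y. norm y > R \<longrightarrow> 0 \<le> -1 * mpoly_eval f y)"
  proof (rule ccontr)
    assume "\<not> ?thesis"
    then obtain y z where "norm y > R" "mpoly_eval f y < 0" "norm z > R" "mpoly_eval f z > 0"
      by (auto simp: not_le)
    \<comment> \<open>Values of both signs in a connected image force a zero outside the ball, where
      \<open>R\<close> allows none.\<close>
    then have "0 \<in> mpoly_eval f ` ?U"
      using connectedD_interval[OF conn, of "mpoly_eval f y" "mpoly_eval f z" 0]
      by (simp add: not_le)
    then show False
      using R by force
  qed
  \<comment> \<open>Taking c = 1 yields the first alternative; c = -1 yields the second, once
    negation turns a lower bound into an upper one.\<close>
  have *: "bdd_below (range (\<lambda>x. c * mpoly_eval f x)) \<and>
      (\<forall>\<Delta>\<in>newton_boundary_infinity f. \<forall>x. 0 \<le> c * mpoly_eval (face_part f \<Delta>) x)"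
    if c: "\<forall>y. norm y > R \<longrightarrow> 0 \<le> c * mpoly_eval f y" for c
  proof (intro conjI ballI allI)
    show "bdd_below (range (\<lambda>x. c * mpoly_eval f x))"
      using c by (intro bdd_below_range_if_nonneg_outside_ball[of R]
          continuous_on_mult continuous_on_const continuous_on_mpoly_eval) blast
    show "0 \<le> c * mpoly_eval (face_part f \<Delta>) x"
      if "\<Delta> \<in> newton_boundary_infinity f" for \<Delta> x
      using that c by (intro face_part_sign[of R]) blast+
  qed
  have "bdd_above (range (mpoly_eval f))"
    if "bdd_below (range (\<lambda>x. -1 * mpoly_eval f x))"
    using that bdd_below_uminus[of "range (mpoly_eval f)"] by (simp add: image_image)
  then show "(bdd_below (range (mpoly_eval f)) \<and>
        (\<forall>\<Delta>\<in>newton_boundary_infinity f. \<forall>x. mpoly_eval (face_part f \<Delta>) x \<ge> 0)) \<or>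
     (bdd_above (range (mpoly_eval f)) \<and>
        (\<forall>\<Delta>\<in>newton_boundary_infinity f. \<forall>x. mpoly_eval (face_part f \<Delta>) x \<le> 0))"
    using sign *[of 1] *[of "-1"] by auto
qed

end
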